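(* Let $d\ge 1$, let $Q_d=(0,1)^d\subset\mathbb{R}^d$, and let $$\mathcal{L}=\{x=(x_1,\dots,x_d)\in\mathbb{R}^d:\ \exists\, i \text{ such that } x_i\in\mathbb{Z}\setminus\{0\}\}.$$ Let $\mu$ be a positive, locally finite Borel measure on $\mathbb{R}^d$ such that $$\mathbf{1}_{Q_d}*(\mu+\delta_0)=1\quad\text{a.e. on }\mathbb{R}^d.$$ Then $\operatorname{supp}(\mu)\subset\mathcal{L}$.
   Context: $\mathbf{1}_E$ is the indicator function of $E$, $\delta_0$ is the Dirac measure at the origin, and $(\mathbf{1}_E*\mu)(x)=\int \mathbf{1}_E(x-y)\,d\mu(y)$. A positive measure means a non-negative Borel measure; it is locally finite if every open ball has finite measure. $\operatorname{supp}(\mu)$ is the closed support of $\mu$. "A.e." refers to Lebesgue measure. *)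

theory Defs
  imports "HOL-Analysis.Analysis" "HOL-Probability.Probability"
begin

text \<open>
  Intended for two measures on the same measurable space; the space and the
  sigma-algebra are read off from the first argument.
\<close>
definition add_measure :: "'a measure \<Rightarrow> 'a measure \<Rightarrow> 'a measure" where
  "add_measure M N = measure_of (space M) (sets M) (\<lambda>A. emeasure M A + emeasure N A)"

lemma space_add_measure [simp]: "space (add_measure M N) = space M"
  by (simp add: add_measure_def)

lemma sets_add_measure [simp]: "sets (add_measure M N) = sets M"
  by (simp add: add_measure_def)

lemma emeasure_add_measure:
  assumes "sets N = sets M" and "A \<in> sets M"
  shows "emeasure (add_measure M N) A = emeasure M A + emeasure N A"
proof (rule emeasure_measure_of[OF add_measure_def])
  show "sets M \<subseteq> Pow (space M)" by (rule sets.space_closed)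
  show "positive (sets (add_measure M N)) (\<lambda>A. emeasure M A + emeasure N A)"
    by (simp add: positive_def)
  show "countably_additive (sets (add_measure M N)) (\<lambda>A. emeasure M A + emeasure N A)"
    using assms(1)
    by (auto simp: countably_additive_def suminf_add[symmetric] suminf_emeasure)
qed (use assms in simp)

text \<open>A Borel measure is a measure \<open>\<mu>\<close> with \<open>sets \<mu> = sets borel\<close>.\<close>

definition locally_finite_measure :: "'a::metric_space measure \<Rightarrow> bool" where
  "locally_finite_measure \<mu> \<longleftrightarrow> (\<forall>x r. emeasure \<mu> (ball x r) < \<infinity>)"

text \<open>The complement of the union of all open null sets.\<close>
definition closed_support :: "'a::topological_space measure \<Rightarrow> 'a set" where
  "closed_support \<mu> = - \<Union>{U. open U \<and> emeasure \<mu> U = 0}"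

definition indicator_conv :: "'a::ab_group_add set \<Rightarrow> 'a measure \<Rightarrow> 'a \<Rightarrow> ennreal" where
  "indicator_conv E \<mu> x = (\<integral>\<^sup>+ y. indicator E (x - y) \<partial>\<mu>)"

definition open_unit_cube :: "(real ^ 'n) set" where
  "open_unit_cube = {x. \<forall>i. 0 < x $ i \<and> x $ i < 1}"

definition nonzero_integer_hyperplanes :: "(real ^ 'n) set" where
  "nonzero_integer_hyperplanes = {x. \<exists>i. x $ i \<in> \<int> - {0}}"

end

theory Submission
  imports Defs
begin

text \<open>
  Put \<open>\<nu> = \<mu> + \<delta>\<^sub>0\<close>.  By continuity along good points, every half-open unit cube has
  \<open>\<nu>\<close>-measure exactly 1.  If a measure on the line gives mass 1 to all half-open unit intervals,
  it is 1-periodic on short intervals, so it also gives mass 1 to a unit interval that was cut in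
  two pieces, one of which was moved by an integer.  Applied to one coordinate after the other,
  this shows that every product of such split intervals has \<open>\<nu>\<close>-measure 1.  If no coordinate of
  \<open>x\<close> is a nonzero integer, there is such a product with both \<open>0\<close> and \<open>x\<close> in its interior; the
  atom at \<open>0\<close> already accounts for its whole mass, so \<open>\<mu>\<close> vanishes near \<open>x\<close>.
\<close>

section \<open>Split unit intervals on the line\<close>

definition split_interval :: "real \<Rightarrow> real \<Rightarrow> int \<Rightarrow> real set" where
  "split_interval a b k = {a<..b} \<union> {b + of_int k<..a + 1 + of_int k}"

lemma split_interval_measurable [measurable]: "split_interval a b k \<in> sets borel"
  by (simp add: split_interval_def)

lemma emeasure_Ioc_add:
  fixes a b c :: real
  assumes "sets M = sets borel" "a \<le> b" "b \<le> c"
  shows "emeasure M {a<..c} = emeasure M {a<..b} + emeasure M {b<..c}"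
proof -
  have "{a<..c} = {a<..b} \<union> {b<..c}" using assms by auto
  then show ?thesis using assms(1) by (simp add: plus_emeasure)
qed

text \<open>For shift 1, \<open>{c<..c + 1}\<close> and \<open>{d<..d + 1}\<close> both have mass 1
  and overlap in \<open>{d<..c + 1}\<close>; the overlap has finite mass, so it cancels. Induction
  in both directions reaches every integer \<open>k\<close>.\<close>

lemma emeasure_Ioc_shift:
  fixes a b :: real
  assumes M: "sets M = sets borel"
    and unit: "\<And>t. emeasure M {t<..t + 1} = 1"
    and ab: "a \<le> b" "b \<le> a + 1"
  shows "emeasure M {a + of_int k<..b + of_int k} = emeasure M {a<..b}"
proof -
  have step: "emeasure M {c + 1<..d + 1} = emeasure M {c<..d}" if "c \<le> d" "d \<le> c + 1" for c d
  proof -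
    have 1: "emeasure M {c<..d} + emeasure M {d<..c + 1} = 1"
      using emeasure_Ioc_add[OF M that] unit by simp
    have "emeasure M {d<..c + 1} + emeasure M {c + 1<..d + 1} = 1"
      using emeasure_Ioc_add[OF M that(2), of "d + 1"] that unit by simp
    with 1 have "emeasure M {d<..c + 1} + emeasure M {c + 1<..d + 1}
        = emeasure M {d<..c + 1} + emeasure M {c<..d}"
      by (simp add: add.commute)
    moreover have "emeasure M {d<..c + 1} \<noteq> \<infinity>"
      using 1 by (metis ennreal_add_eq_top ennreal_one_neq_top infinity_ennreal_def)
    ultimately show ?thesis
      by (simp add: ennreal_add_left_cancel)
  qed
  show ?thesis
  proof (induction k rule: int_induct[where k = 0])
    case (step1 i)
    then show ?case using step[of "a + i" "b + i"] ab by (simp add: add.assoc)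
  next
    case (step2 i)
    then show ?case using step[of "a + (i - 1)" "b + (i - 1)"] ab by simp
  qed simp
qed

lemma emeasure_split_interval:
  assumes M: "sets M = sets borel"
    and unit: "\<And>t. emeasure M {t<..t + 1 :: real} = 1"
    and ab: "a \<le> b" "b \<le> a + 1"
  shows "emeasure M (split_interval a b k) = 1"
proof -
  \<comment> \<open>The moved piece starts at or after \<open>b\<close> if \<open>k \<ge> 0\<close>,
    and ends at or before \<open>a\<close> if \<open>k \<le> -1\<close>.\<close>
  have "{a<..b} \<inter> {b + of_int k<..a + 1 + of_int k} = {}"
  proof (cases "k \<ge> 0")
    case False
    then have "real_of_int k \<le> -1" by linarith
    then show ?thesis by auto
  qed auto
  then have "emeasure M (split_interval a b k)
      = emeasure M {a<..b} + emeasure M {b + of_int k<..a + 1 + of_int k}"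
    unfolding split_interval_def using M by (simp add: plus_emeasure)
  also have "\<dots> = emeasure M {a<..b} + emeasure M {b<..a + 1}"
    using emeasure_Ioc_shift[OF M unit, of b "a + 1" k] ab by simp
  also have "\<dots> = 1"
    using emeasure_Ioc_add[OF M ab] unit by simp
  finally show ?thesis .
qed

section \<open>Products of split intervals\<close>

text \<open>Induction over the set \<open>S\<close> of coordinates already split. The remaining
  sides stay unit intervals with arbitrary corner \<open>c\<close>, because splitting coordinate
  \<open>j\<close> uses the induction hypothesis for all translates in that direction.\<close>

lemma emeasure_split_box:
  fixes \<nu> :: "(real ^ 'n) measure"
  assumes N [measurable_cong]: "sets \<nu> = sets borel"
    and unit: "\<And>c. emeasure \<nu> {y. \<forall>i. y $ i \<in> {c i<..c i + 1}} = 1"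
    and ab: "\<And>i. a i \<le> b i" "\<And>i. b i \<le> a i + 1"
  shows "emeasure \<nu> {y. \<forall>i. y $ i \<in> split_interval (a i) (b i) (k i)} = 1"
proof -
  have "\<forall>c. emeasure \<nu> {y. \<forall>i. y $ i \<in>
      (if i \<in> S then split_interval (a i) (b i) (k i) else {c i<..c i + 1})} = 1"
    if "finite S" for S :: "'n set"
    using that
  proof (induction S rule: finite_induct)
    case empty
    then show ?case using unit by simp
  next
    case (insert j S)
    show ?case
    proof
      fix c :: "'n \<Rightarrow> real"
      define E where "E i = (if i \<in> S then split_interval (a i) (b i) (k i) else {c i<..c i + 1})"
        for i
      have [measurable]: "E i \<in> sets borel" for i by (simp add: E_def)
      define F where "F = {y :: real ^ 'n. \<forall>i. i \<noteq> j \<longrightarrow> y $ i \<in> E i}"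
      have F [measurable]: "F \<in> sets \<nu>"
        unfolding N F_def by measurable
      have sp: "space \<nu> = UNIV" using sets_eq_imp_space_eq[OF N] by simp
      \<comment> \<open>Restricting \<nu> to \<open>F\<close> and projecting to coordinate
        \<open>j\<close> turns the problem into one about a measure on the line.\<close>
      define M where "M = distr (density \<nu> (indicator F)) borel (\<lambda>y. y $ j)"
      have M: "emeasure M A = emeasure \<nu> {y. y $ j \<in> A \<and> y \<in> F}" if [measurable]: "A \<in> sets borel" for A
      proof -
        have "emeasure M A = emeasure (density \<nu> (indicator F)) ((\<lambda>y. y $ j) -` A \<inter> UNIV)"
          unfolding M_def by (subst emeasure_distr) (auto simp: sp)
        also have "\<dots> = (\<integral>\<^sup>+ y. indicator F y * indicator ((\<lambda>y. y $ j) -` A) y \<partial>\<nu>)"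
          by (subst emeasure_density) (auto simp: sp N intro!: measurable_sets_borel[OF _ that])
        also have "\<dots> = (\<integral>\<^sup>+ y. indicator {y. y $ j \<in> A \<and> y \<in> F} y \<partial>\<nu>)"
          by (intro nn_integral_cong) (auto simp: indicator_def)
        also have "\<dots> = emeasure \<nu> {y. y $ j \<in> A \<and> y \<in> F}"
          by (rule nn_integral_indicator) (use F in \<open>simp add: N\<close>)
        finally show ?thesis .
      qed
      \<comment> \<open>This is the induction hypothesis with corner
        \<open>c(j := t)\<close>.\<close>
      have "emeasure M {t<..t + 1} = 1" for t
      proof -
        have "{y. y $ j \<in> {t<..t + 1} \<and> y \<in> F} = {y. \<forall>i. y $ i \<in>
            (if i \<in> S then split_interval (a i) (b i) (k i) else {(c(j := t)) i<..(c(j := t)) i + 1})}"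
          using insert.hyps by (auto simp: F_def E_def split: if_splits)
        then show ?thesis using insert.IH by (simp add: M)
      qed
      then have "emeasure M (split_interval (a j) (b j) (k j)) = 1"
        using ab by (intro emeasure_split_interval) (auto simp: M_def)
      moreover have "{y. y $ j \<in> split_interval (a j) (b j) (k j) \<and> y \<in> F} = {y. \<forall>i. y $ i \<in>
            (if i \<in> insert j S then split_interval (a i) (b i) (k i) else {c i<..c i + 1})}"
        using insert.hyps by (auto simp: F_def E_def split: if_splits)
      ultimately show "emeasure \<nu> {y. \<forall>i. y $ i \<in>
            (if i \<in> insert j S then split_interval (a i) (b i) (k i) else {c i<..c i + 1})} = 1"
        by (simp add: M)
    qed
  qed
  from this[of UNIV] show ?thesis by simp
qed

section \<open>From the convolution identity to half-open cubes\<close>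

text \<open>The convolution at \<open>z\<close> is the mass of the open unit cube with upper corner
  \<open>z\<close>. Good points \<open>z n\<close> tend to the upper corner \<open>?x\<close> of the
  target cube, strictly from above in every coordinate; the indicators then converge everywhere to
  that of the half-open cube, and dominated convergence applies.\<close>

lemma emeasure_half_open_unit_cube:
  fixes \<nu> :: "(real ^ 'n) measure"
  assumes N [measurable_cong]: "sets \<nu> = sets borel"
    and fin: "locally_finite_measure \<nu>"
    and ae: "AE x in lborel. indicator_conv open_unit_cube \<nu> x = 1"
  shows "emeasure \<nu> {y. \<forall>i. y $ i \<in> {c i<..c i + 1}} = 1"
proof -
  have sp: "space \<nu> = UNIV" using sets_eq_imp_space_eq[OF N] by simp
  let ?x = "(\<chi> i. c i + 1) :: real ^ 'n"
  let ?H = "{y :: real ^ 'n. \<forall>i. y $ i \<in> {c i<..c i + 1}}"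
  \<comment> \<open>A nonempty open box is not a null set, so it contains a point where the identity
    holds.\<close>
  have "\<exists>z. z \<in> box ?x (\<chi> i. c i + 1 + 1 / Suc n) \<and> indicator_conv open_unit_cube \<nu> z = 1" for n
  proof (rule ccontr)
    let ?B = "box ?x (\<chi> i. c i + 1 + 1 / Suc n)"
    assume "\<not> ?thesis"
    then have "AE z in lborel. z \<notin> ?B"
      using ae by (auto elim: eventually_mono)
    then have "?B \<in> null_sets lborel"
      by (subst (asm) AE_iff_null_sets[symmetric]) auto
    then have "?B \<in> null_sets lebesgue"
      using null_sets_completionI by blast
    then have "?B = {}"
      using open_not_negligible open_box negligible_iff_null_sets by blast
    moreover have "(\<chi> i. c i + 1 + 1 / (2 * Suc n)) \<in> ?B"
      by (simp add: mem_box_cart field_simps)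
    ultimately show False by blast
  qed
  then obtain z where z: "\<And>n. z n \<in> box ?x (\<chi> i. c i + 1 + 1 / Suc n)"
    and conv: "\<And>n. indicator_conv open_unit_cube \<nu> (z n) = 1"
    by metis
  have z_bounds: "\<And>n i. c i + 1 < z n $ i" "\<And>n i. z n $ i < c i + 1 + 1 / Suc n"
    using z by (auto simp: mem_box_cart)
  have z_lim: "(\<lambda>n. z n $ i) \<longlonglongrightarrow> c i + 1" for i
  proof (rule real_tendsto_sandwich[where f = "\<lambda>_. c i + 1"])
    show "(\<lambda>n. c i + 1 + 1 / Suc n) \<longlonglongrightarrow> c i + 1"
      using tendsto_add[OF tendsto_const LIMSEQ_inverse_real_of_nat, of "c i + 1"]
      by (simp add: inverse_eq_divide)
  qed (use z_bounds in \<open>auto intro!: always_eventually less_imp_le\<close>)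
  have ind: "indicator open_unit_cube (z n - y) = (1 :: ennreal) \<longleftrightarrow>
      (\<forall>i. z n $ i - 1 < y $ i \<and> y $ i < z n $ i)" for n y
    by (auto simp: open_unit_cube_def indicator_def algebra_simps)
  \<comment> \<open>Since \<open>1 / Suc n \<le> 1\<close>, this bounded box contains all the open
    cubes; local finiteness makes its indicator an integrable bound.\<close>
  let ?K = "cbox (\<chi> i. c i) (\<chi> i. c i + 2) :: (real ^ 'n) set"
  have "(\<lambda>n. \<integral>\<^sup>+ y. indicator open_unit_cube (z n - y) \<partial>\<nu>) \<longlonglongrightarrow> (\<integral>\<^sup>+ y. indicator ?H y \<partial>\<nu>)"
  proof (rule nn_integral_dominated_convergence[where w = "indicator ?K"])
    have cube [measurable]: "open_unit_cube \<in> sets (borel :: (real ^ 'n) measure)"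
      unfolding open_unit_cube_def by measurable
    show "(\<lambda>y. indicator open_unit_cube (z n - y)) \<in> borel_measurable \<nu>" for n
      by measurable
    show "indicator ?H \<in> borel_measurable \<nu>"
      by measurable
    show "indicator ?K \<in> borel_measurable \<nu>"
      by measurable
    show "AE y in \<nu>. indicator open_unit_cube (z n - y) \<le> (indicator ?K y :: ennreal)" for n
    proof (rule AE_I2)
      fix y
      have "y \<in> ?K" if "z n - y \<in> open_unit_cube"
      proof -
        have "c i \<le> y $ i \<and> y $ i \<le> c i + 2" for i
        proof -
          have "0 < z n $ i - y $ i \<and> z n $ i - y $ i < 1"
            using that by (auto simp: open_unit_cube_def)
          moreover have "1 / real (Suc n) \<le> 1" by simp
          ultimately show ?thesis using z_bounds(1)[of i n] z_bounds(2)[of n i] by linarith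
        qed
        then show ?thesis by (simp add: mem_box_cart)
      qed
      then show "indicator open_unit_cube (z n - y) \<le> (indicator ?K y :: ennreal)"
        by (auto simp: indicator_def)
    qed
    obtain r where "?K \<subseteq> ball 0 r"
      using bounded_subset_ballD[OF bounded_cbox] by blast
    then have "emeasure \<nu> ?K \<le> emeasure \<nu> (ball 0 r)"
      by (rule emeasure_mono) (simp add: N)
    also have "\<dots> < \<infinity>"
      using fin by (auto simp: locally_finite_measure_def)
    finally show "(\<integral>\<^sup>+ y. indicator ?K y \<partial>\<nu>) < \<infinity>"
      by (simp add: N)
    show "AE y in \<nu>. (\<lambda>n. indicator open_unit_cube (z n - y)) \<longlonglongrightarrow> (indicator ?H y :: ennreal)"
    proof (rule AE_I2, rule tendsto_eventually)
      fix y :: "real ^ 'n"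
      show "\<forall>\<^sub>F n in sequentially. indicator open_unit_cube (z n - y) = (indicator ?H y :: ennreal)"
      proof (cases "y \<in> ?H")
        \<comment> \<open>The upper bound \<open>y $ i \<le> c i + 1 < z n $ i\<close> holds for all
          \<open>n\<close>, which is why the upper faces belong to the limit; the lower bound holds
          eventually because \<open>c i < y $ i\<close>.\<close>
        case True
        have "\<forall>\<^sub>F n in sequentially. \<forall>i. z n $ i < y $ i + 1"
          using True by (intro eventually_all_finite order_tendstoD(2)[OF z_lim]) auto
        then show ?thesis
        proof eventually_elim
          case (elim n)
          have "z n $ i - 1 < y $ i \<and> y $ i < z n $ i" for i
          proof -
            have "y $ i \<le> c i + 1" using True by auto
            then show ?thesis using elim[rule_format, of i] z_bounds(1)[of i n] by linarith
          qed
          then show ?case using True ind by simp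
        qed
      next
        \<comment> \<open>One bad coordinate suffices: at or below \<open>c i\<close> it excludes
          \<open>y\<close> for every \<open>n\<close>, above \<open>c i + 1\<close> it does so
          eventually.\<close>
        case False
        then obtain i where i: "y $ i \<le> c i \<or> c i + 1 < y $ i"
          by (auto simp: not_less not_le)
        have "\<forall>\<^sub>F n in sequentially. \<not> (z n $ i - 1 < y $ i \<and> y $ i < z n $ i)"
          using i
        proof
          assume "y $ i \<le> c i"
          then have "\<not> z n $ i - 1 < y $ i" for n
            using z_bounds(1)[of i n] by linarith
          then show ?thesis by simp
        next
          assume "c i + 1 < y $ i"
          from order_tendstoD(2)[OF z_lim this] show ?thesis
            by (auto elim: eventually_mono)
        qed
        then show ?thesis
        proof eventually_elim
          case (elim n)
          then have "z n - y \<notin> open_unit_cube"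
            by (auto simp: open_unit_cube_def algebra_simps dest!: spec[of _ i])
          then show ?case using False by simp
        qed
      qed
    qed
  qed
  then have "(\<lambda>n. 1) \<longlonglongrightarrow> emeasure \<nu> ?H"
    using conv by (simp add: indicator_conv_def)
  then show ?thesis
    using LIMSEQ_unique tendsto_const by blast
qed

section \<open>A null neighbourhood of a point off the hyperplanes\<close>

text \<open>A split interval meets each class modulo 1 exactly once, so it cannot contain both 0 and
  a nonzero integer. For nonintegral \<open>x\<close>, \<open>frac x\<close> lies strictly between
  \<open>b = frac x / 2\<close> and \<open>a + 1 = frac x / 2 + 1 / 2\<close>; moving that piece by
  the floor of \<open>x\<close> captures \<open>x\<close>, while 0 stays inside the first
  piece.\<close>

lemma split_interval_around:
  fixes x :: real
  assumes "x \<notin> \<int> - {0}"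
  obtains a b :: real and k :: int where "a \<le> b" "b \<le> a + 1" "a < 0" "0 < b"
    "x \<in> {a<..<b} \<union> {b + of_int k<..<a + 1 + of_int k}"
proof (cases "x = 0")
  case True
  then show ?thesis by (intro that[of "-1/2" "1/2" 0]) auto
next
  case False
  then have "x \<notin> \<int>" using assms by auto
  then have f: "0 < frac x" "frac x < 1"
    by (simp_all add: frac_lt_1 frac_gt_0_iff)
  then have "frac x / 2 + of_int \<lfloor>x\<rfloor> < x" "x < frac x / 2 - 1 / 2 + 1 + of_int \<lfloor>x\<rfloor>"
    by (simp_all add: frac_def field_simps)
  with f show ?thesis
    by (intro that[of "frac x / 2 - 1 / 2" "frac x / 2" "\<lfloor>x\<rfloor>"]) simp_all
qed

theorem theorem1p2:
  fixes \<mu> :: "(real ^ 'n) measure"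
  assumes "sets \<mu> = sets borel"
    and "locally_finite_measure \<mu>"
    and "AE x in lborel.
      indicator_conv open_unit_cube (add_measure \<mu> (return borel 0)) x = 1"
  shows "closed_support \<mu> \<subseteq> nonzero_integer_hyperplanes"
proof (rule ccontr)
  let ?\<nu> = "add_measure \<mu> (return borel 0)"
  have N: "sets ?\<nu> = sets borel" using assms(1) by simp
  have em: "emeasure ?\<nu> A = emeasure \<mu> A + indicator A 0" if "A \<in> sets borel" for A
    using that assms(1) by (simp add: emeasure_add_measure)
  have fin: "locally_finite_measure ?\<nu>"
    using assms(2) by (auto simp: locally_finite_measure_def em indicator_def)
  assume "\<not> ?thesis"
  then obtain x where x: "x \<in> closed_support \<mu>" "\<And>i. x $ i \<notin> \<int> - {0}"
    by (auto simp: nonzero_integer_hyperplanes_def)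
  have "\<exists>a b k. a \<le> b \<and> b \<le> a + 1 \<and> a < 0 \<and> 0 < b \<and>
    x $ i \<in> {a<..<b} \<union> {b + of_int k<..<a + 1 + of_int k}" for i
    using split_interval_around[OF x(2), of i] by metis
  then obtain a b and k :: "'n \<Rightarrow> int"
    where ab: "\<And>i. a i \<le> b i" "\<And>i. b i \<le> a i + 1" "\<And>i. a i < 0" "\<And>i. 0 < b i"
      and xi: "\<And>i. x $ i \<in> {a i<..<b i} \<union> {b i + of_int (k i)<..<a i + 1 + of_int (k i)}"
    by metis
  let ?E = "{y :: real ^ 'n. \<forall>i. y $ i \<in> split_interval (a i) (b i) (k i)}"
  \<comment> \<open>Dropping the right endpoints makes the set open and keeps \<open>x\<close> in
    it, so a null \<open>U\<close> contradicts \<open>x\<close> being in the support.\<close>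
  define U where "U = {y :: real ^ 'n. \<forall>i. y $ i \<in>
    {a i<..<b i} \<union> {b i + of_int (k i)<..<a i + 1 + of_int (k i)}}"
  have E: "?E \<in> sets borel" by measurable
  have "emeasure ?\<nu> ?E = 1"
    by (rule emeasure_split_box[OF N emeasure_half_open_unit_cube[OF N fin assms(3)] ab(1,2)])
  moreover have "0 \<in> ?E"
    using ab by (auto simp: split_interval_def less_imp_le)
  ultimately have "1 + emeasure \<mu> ?E = 1 + 0"
    using em[OF E] by (simp add: add.commute)
  then have "emeasure \<mu> ?E = 0"
    by (subst (asm) ennreal_add_left_cancel) simp
  moreover have "U \<subseteq> ?E"
    unfolding U_def split_interval_def
    by (rule Collect_mono, rule impI, rule allI, erule allE) auto
  ultimately have "emeasure \<mu> U = 0"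
    using emeasure_mono[of U ?E \<mu>] E assms(1) by simp
  moreover have "open U"
  proof -
    have "U = (\<Inter>i. (\<lambda>y. y $ i) -` ({a i<..<b i} \<union> {b i + of_int (k i)<..<a i + 1 + of_int (k i)}))"
      by (auto simp: U_def)
    also have "open \<dots>"
      by (intro open_INT open_vimage ballI open_Un continuous_intros) auto
    finally show ?thesis .
  qed
  moreover have "x \<in> U" using xi by (simp add: U_def)
  ultimately show False using x(1) by (auto simp: closed_support_def)
qed

end
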